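(* Let $a,b,d\ge 1$ be integers with $\gcd(a,b)=1$, let $\rho=dab(a+b)$, $B^{+}=(b-1)(a+b)-b(d+1)$, $\mathbf h=(b,-(a+b),a)$, and let $t>da$ be an integer with $\gcd(t,d)=1$ and $t>B^{+}$. For $\mathbf v\in\mathcal S_{1,2}^{+}(t)$, the element $\widehat\varphi_{1,2}^{+}(\mathbf v)\in\mathcal S_{1,2}^{+}(t+\rho)$ is reducible in $\mathcal O_{t+\rho}^{+}$ if and only if $\mathbf v$ is reducible in $\mathcal O_t^{+}$. Likewise, for $\mathbf v\in\mathcal S_{0,2}^{+}(t)$, $\widehat\varphi_{0,2}^{+}(\mathbf v)$ is reducible in $\mathcal O_{t+\rho}^{+}$ if and only if $\mathbf v$ is reducible in $\mathcal O_t^{+}$. Thus $$\mathcal H(\mathcal O_{t+\rho}^{+})=\bigcup_{j\in\{0,1\}}\widehat\varphi_{j,2}^{+}\big(\mathcal H(\mathcal O_t^{+})\cap\mathcal S_{j,2}^{+}(t)\big)\ \cup\ \{\varphi_{1,2}(\boldsymbol\alpha),\ \varphi_{1,2}(\boldsymbol\alpha)+\mathbf h,\ \ldots,\ \varphi_{0,2}(\boldsymbol\beta)\},$$ and in particular $|\mathcal H(\mathcal O_{t+\rho}^{+})|=|\mathcal H(\mathcal O_t^{+})|+da$.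
   Context: For an integer $s$, $\mathbb L_s=\{(v_0,v_1,v_2)\in\mathbb Z^3:(s-da)v_0+sv_1+(s+db)v_2=0\}$, $\mathcal O_s^{+}=\{\mathbf v\in\mathbb L_s : v_0\ge 0,\ v_1\ge 0\}$, $\mathcal S_{1,2}^{+}(s)=\{\mathbf v\in\mathcal O_s^{+}: v_0<b\}$ and $\mathcal S_{0,2}^{+}(s)=\{\mathbf v\in\mathcal O_s^{+}: v_1<a+b\}$. An element of $\mathcal O_s^{+}$ is reducible if it is a sum of two nonzero elements of $\mathcal O_s^{+}$; the Hilbert basis $\mathcal H(\mathcal O_s^{+})$ is the (finite) set of minimal generators of the additive monoid $\mathcal O_s^{+}$, i.e. its nonzero non-reducible elements. With $\ell(\mathbf v)=v_0+v_1+v_2$ and standard basis vectors $\mathbf e_0,\mathbf e_1,\mathbf e_2$ (indexed by coordinates $0,1,2$), let $\varphi_{1,2}(\mathbf v)=\mathbf v+a(a+b)\ell(\mathbf v)(\mathbf e_1-\mathbf e_2)$ and $\varphi_{0,2}(\mathbf v)=\mathbf v+ab\,\ell(\mathbf v)(\mathbf e_0-\mathbf e_2)$, linear maps $\mathbb L_t\to\mathbb L_{t+\rho}$; for $t>B^+$ they restrict to maps $\widehat\varphi_{j,2}^{+}:\mathcal S_{j,2}^{+}(t)\to\mathcal S_{j,2}^{+}(t+\rho)$, $j\in\{0,1\}$. For $t>B^{+}$ there are elements of $\mathcal O_t^{+}$ of length $d$, and any two of them differ by an integer multiple of $\mathbf h$; $\boldsymbol\alpha$ denotes the one with minimal coordinate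 $0$ (so $0\le\alpha_0<b$) and $\boldsymbol\beta$ the one with minimal coordinate $1$ (so $0\le\beta_1<a+b$). The last set in the display is the set of all $\varphi_{1,2}(\boldsymbol\alpha)+k\mathbf h$ with $0\le k\le m$, where $m$ is the nonnegative integer with $\varphi_{1,2}(\boldsymbol\alpha)+m\mathbf h=\varphi_{0,2}(\boldsymbol\beta)$. *)

theory Defs
  imports "HOL-Analysis.Analysis"
begin

(* The index type 3 is the ring of integers modulo 3, so the literals 0, 1, 2 of type 3 are
   its three distinct elements and serve as the coordinate indices 0, 1, 2. *)

definition lat :: "int \<Rightarrow> int \<Rightarrow> int \<Rightarrow> int \<Rightarrow> (int ^ 3) set" where
  "lat a b d s = {v. (s - d * a) * v $ 0 + s * v $ 1 + (s + d * b) * v $ 2 = 0}"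

definition Oplus :: "int \<Rightarrow> int \<Rightarrow> int \<Rightarrow> int \<Rightarrow> (int ^ 3) set" where
  "Oplus a b d s = {v \<in> lat a b d s. v $ 0 \<ge> 0 \<and> v $ 1 \<ge> 0}"

definition S12plus :: "int \<Rightarrow> int \<Rightarrow> int \<Rightarrow> int \<Rightarrow> (int ^ 3) set" where
  "S12plus a b d s = {v \<in> Oplus a b d s. v $ 0 < b}"

definition S02plus :: "int \<Rightarrow> int \<Rightarrow> int \<Rightarrow> int \<Rightarrow> (int ^ 3) set" where
  "S02plus a b d s = {v \<in> Oplus a b d s. v $ 1 < a + b}"

definition reducible :: "(int ^ 3) set \<Rightarrow> int ^ 3 \<Rightarrow> bool" where
  "reducible M v \<longleftrightarrow> (\<exists>u\<in>M. \<exists>w\<in>M. u \<noteq> 0 \<and> w \<noteq> 0 \<and> v = u + w)"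

definition hilbert_basis :: "(int ^ 3) set \<Rightarrow> (int ^ 3) set" where
  "hilbert_basis M = {v \<in> M. v \<noteq> 0 \<and> \<not> reducible M v}"

definition len :: "int ^ 3 \<Rightarrow> int" where
  "len v = v $ 0 + v $ 1 + v $ 2"

definition hvec :: "int \<Rightarrow> int \<Rightarrow> int ^ 3" where
  "hvec a b = b *s axis 0 1 + (- (a + b)) *s axis 1 1 + a *s axis 2 1"

definition phi12 :: "int \<Rightarrow> int \<Rightarrow> int ^ 3 \<Rightarrow> int ^ 3" where
  "phi12 a b v = v + (a * (a + b) * len v) *s (axis 1 1 - axis 2 1)"

definition phi02 :: "int \<Rightarrow> int \<Rightarrow> int ^ 3 \<Rightarrow> int ^ 3" where
  "phi02 a b v = v + (a * b * len v) *s (axis 0 1 - axis 2 1)"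

definition rho :: "int \<Rightarrow> int \<Rightarrow> int \<Rightarrow> int" where
  "rho a b d = d * a * b * (a + b)"

definition Bplus :: "int \<Rightarrow> int \<Rightarrow> int \<Rightarrow> int" where
  "Bplus a b d = (b - 1) * (a + b) - b * (d + 1)"

(* The choices made by arg_min below are unique; see alpha_vec_unique and beta_vec_unique. *)

definition alpha_vec :: "int \<Rightarrow> int \<Rightarrow> int \<Rightarrow> int \<Rightarrow> int ^ 3" where
  "alpha_vec a b d t = arg_min (\<lambda>v. v $ 0) (\<lambda>v. v \<in> Oplus a b d t \<and> len v = d)"

definition beta_vec :: "int \<Rightarrow> int \<Rightarrow> int \<Rightarrow> int \<Rightarrow> int ^ 3" where
  "beta_vec a b d t = arg_min (\<lambda>v. v $ 1) (\<lambda>v. v \<in> Oplus a b d t \<and> len v = d)"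

lemma UNIV_3_012: "(UNIV :: 3 set) = {0, 1, 2}"
proof -
  have "(3::3) = 0" by simp
  then show ?thesis using UNIV_3 by auto
qed

lemma index3_distinct [simp]:
  "(0::3) \<noteq> 1" "(0::3) \<noteq> 2" "(1::3) \<noteq> 2" "(1::3) \<noteq> 0" "(2::3) \<noteq> 0" "(2::3) \<noteq> 1"
  by simp_all

lemma vec3_eq_iff: "v = w \<longleftrightarrow> v $ 0 = w $ 0 \<and> v $ 1 = w $ 1 \<and> v $ 2 = w $ 2"
  for v w :: "int ^ 3"
proof -
  have "v = w \<longleftrightarrow> (\<forall>i\<in>UNIV. v $ i = w $ i)" by (simp add: vec_eq_iff)
  then show ?thesis by (simp add: UNIV_3_012)
qed

lemma ex_vec3: "\<exists>v::int ^ 3. v $ 0 = x \<and> v $ 1 = y \<and> v $ 2 = z"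
  by (rule exI[of _ "\<chi> i. if i = 0 then x else if i = 1 then y else z"]) simp

lemma hvec_nth [simp]: "hvec a b $ 0 = b" "hvec a b $ 1 = - (a + b)" "hvec a b $ 2 = a"
  by (simp_all add: hvec_def axis_def)

lemma phi12_nth [simp]:
  "phi12 a b v $ 0 = v $ 0"
  "phi12 a b v $ 1 = v $ 1 + a * (a + b) * len v"
  "phi12 a b v $ 2 = v $ 2 - a * (a + b) * len v"
  by (simp_all add: phi12_def axis_def)

lemma phi02_nth [simp]:
  "phi02 a b v $ 0 = v $ 0 + a * b * len v"
  "phi02 a b v $ 1 = v $ 1"
  "phi02 a b v $ 2 = v $ 2 - a * b * len v"
  by (simp_all add: phi02_def axis_def)

lemma length_d_iff:
  assumes "d \<ge> (1::int)"
  shows "v \<in> Oplus a b d t \<and> len v = d \<longleftrightarrow>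
    v $ 0 \<ge> 0 \<and> v $ 1 \<ge> 0 \<and> v $ 0 + v $ 1 + v $ 2 = d \<and> a * v $ 0 - b * v $ 2 = t"
proof (cases "v $ 0 + v $ 1 + v $ 2 = d")
  case True
  have "(t - d * a) * v $ 0 + t * v $ 1 + (t + d * b) * v $ 2
      = t * (v $ 0 + v $ 1 + v $ 2) - d * (a * v $ 0 - b * v $ 2)"
    by (simp add: algebra_simps)
  also have "\<dots> = d * (t - (a * v $ 0 - b * v $ 2))"
    unfolding True by (simp add: algebra_simps)
  finally show ?thesis
    using assms True by (auto simp: Oplus_def lat_def len_def)
qed (simp add: len_def)

lemma ex_length_d:
  assumes "a \<ge> 1" "b \<ge> 1" "d \<ge> 1" "coprime a b" "t > Bplus a b d"
  shows "\<exists>v. v \<in> Oplus a b d t \<and> len v = d"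
proof -
  obtain p q where pq: "p * a + q * b = 1"
    using bezout_int[of a b] assms(4) by (auto simp: coprime_iff_gcd_eq_1)
  define x where "x = (p * t) mod b"
  define K where "K = p * t div b"
  have xK: "x = p * t - b * K" by (simp add: x_def K_def minus_mult_div_eq_mod)
  have tpq: "t = p * t * a + q * t * b"
    by (metis pq distrib_right mult.commute mult.left_commute mult_1)
  have "a * x - t = p * t * a - b * (a * K) - t"
    unfolding xK by (simp add: algebra_simps)
  also have "\<dots> = b * (- q * t - a * K)"
    using tpq by (simp add: algebra_simps)
  finally obtain z where z: "a * x - t = b * z" ..
  have x: "0 \<le> x" "x \<le> b - 1" using assms(2) by (auto simp: x_def)
  have "b * (d - x - z) = b * d + t - (a + b) * x"
    using z by (simp add: algebra_simps)
  moreover have "(a + b) * x \<le> (a + b) * (b - 1)"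
    using x(2) assms(1,2) by (intro mult_left_mono) auto
  ultimately have "b * (d - x - z) > b * (-1)"
    using assms(5) by (simp add: Bplus_def algebra_simps)
  then have "d - x - z > -1"
    using assms(2) by (subst (asm) mult_less_cancel_left_pos) auto
  moreover obtain v :: "int ^ 3" where "v $ 0 = x" "v $ 1 = d - x - z" "v $ 2 = z"
    using ex_vec3 by blast
  ultimately show ?thesis
    using x z assms(3) by (intro exI[of _ v], subst length_d_iff) auto
qed

lemma length_d_diff:
  assumes "a \<ge> 1" "b \<ge> 1" "d \<ge> 1" "coprime a b"
    and "v \<in> Oplus a b d t" "len v = d" "w \<in> Oplus a b d t" "len w = d"
  shows "\<exists>k. v - w = k *s hvec a b"
proof -
  have v: "v $ 0 + v $ 1 + v $ 2 = d" "a * v $ 0 - b * v $ 2 = t"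
    using assms(5,6) length_d_iff[OF assms(3)] by blast+
  have w: "w $ 0 + w $ 1 + w $ 2 = d" "a * w $ 0 - b * w $ 2 = t"
    using assms(7,8) length_d_iff[OF assms(3)] by blast+
  have eq: "a * (v $ 0 - w $ 0) = b * (v $ 2 - w $ 2)"
    using v(2) w(2) by (simp add: algebra_simps)
  then have "b dvd v $ 0 - w $ 0"
    by (metis assms(4) coprime_commute coprime_dvd_mult_right_iff dvd_triv_left)
  then obtain k where k: "v $ 0 - w $ 0 = b * k" by blast
  with eq assms(2) have "v $ 2 - w $ 2 = a * k" by simp
  with k v(1) w(1) have "v - w = k *s hvec a b"
    by (simp add: vec3_eq_iff algebra_simps)
  then show ?thesis ..
qed

lemma is_arg_min_exists_int:
  fixes f :: "'a \<Rightarrow> int"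
  assumes "\<exists>v. P v" "\<And>v. P v \<Longrightarrow> f v \<ge> 0"
  shows "is_arg_min f P (arg_min f P)"
proof -
  obtain v where "is_arg_min (nat \<circ> f) P v"
    using assms(1) arg_min_natI[of P _ "nat \<circ> f"] unfolding is_arg_min_linorder
    by (metis arg_min_nat_le)
  then have "is_arg_min f P v"
    using assms(2) by (fastforce simp: is_arg_min_def)
  then show ?thesis unfolding arg_min_def by (rule someI)
qed

lemma alpha_vec_is_arg_min:
  assumes "a \<ge> 1" "b \<ge> 1" "d \<ge> 1" "coprime a b" "t > Bplus a b d"
  shows "is_arg_min (\<lambda>v. v $ 0) (\<lambda>v. v \<in> Oplus a b d t \<and> len v = d) (alpha_vec a b d t)"
  unfolding alpha_vec_def using ex_length_d[OF assms]
  by (rule is_arg_min_exists_int) (simp add: Oplus_def)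

lemma beta_vec_is_arg_min:
  assumes "a \<ge> 1" "b \<ge> 1" "d \<ge> 1" "coprime a b" "t > Bplus a b d"
  shows "is_arg_min (\<lambda>v. v $ 1) (\<lambda>v. v \<in> Oplus a b d t \<and> len v = d) (beta_vec a b d t)"
  unfolding beta_vec_def using ex_length_d[OF assms]
  by (rule is_arg_min_exists_int) (simp add: Oplus_def)

lemma alpha_vec_unique:
  assumes "a \<ge> 1" "b \<ge> 1" "d \<ge> 1" "coprime a b" "t > Bplus a b d"
    and v: "is_arg_min (\<lambda>v. v $ 0) (\<lambda>v. v \<in> Oplus a b d t \<and> len v = d) v"
  shows "v = alpha_vec a b d t"
proof -
  let ?w = "alpha_vec a b d t"
  note w = alpha_vec_is_arg_min[OF assms(1-5)]
  obtain k where k: "v - ?w = k *s hvec a b"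
    using length_d_diff[OF assms(1-4)] v w unfolding is_arg_min_def by blast
  have "v $ 0 = ?w $ 0" using v w unfolding is_arg_min_def by (metis linorder_neqE)
  then have "k = 0" using k assms(2) by (simp add: vec3_eq_iff)
  with k show ?thesis by simp
qed

lemma beta_vec_unique:
  assumes "a \<ge> 1" "b \<ge> 1" "d \<ge> 1" "coprime a b" "t > Bplus a b d"
    and v: "is_arg_min (\<lambda>v. v $ 1) (\<lambda>v. v \<in> Oplus a b d t \<and> len v = d) v"
  shows "v = beta_vec a b d t"
proof -
  let ?w = "beta_vec a b d t"
  note w = beta_vec_is_arg_min[OF assms(1-5)]
  obtain k where k: "v - ?w = k *s hvec a b"
    using length_d_diff[OF assms(1-4)] v w unfolding is_arg_min_def by blast
  have "v $ 1 = ?w $ 1" using v w unfolding is_arg_min_def by (metis linorder_neqE)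
  then have "k = 0" using k assms(1,2) by (auto simp: vec3_eq_iff)
  with k show ?thesis by simp
qed

lemma alpha_vec_lt:
  assumes "a \<ge> 1" "b \<ge> 1" "d \<ge> 1" "coprime a b" "t > Bplus a b d"
  shows "0 \<le> alpha_vec a b d t $ 0" "alpha_vec a b d t $ 0 < b"
proof -
  let ?w = "alpha_vec a b d t"
  note w = alpha_vec_is_arg_min[OF assms(1-5)]
  show "0 \<le> ?w $ 0" using w by (simp add: is_arg_min_def Oplus_def)
  show "?w $ 0 < b"
  proof (rule ccontr)
    assume "\<not> ?w $ 0 < b"
    then have "?w - hvec a b \<in> Oplus a b d t \<and> len (?w - hvec a b) = d"
      using w assms(1-3) unfolding is_arg_min_def length_d_iff[OF assms(3)]
      by (simp add: algebra_simps)
    then show False using w assms(2) unfolding is_arg_min_def by force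
  qed
qed

lemma beta_vec_lt:
  assumes "a \<ge> 1" "b \<ge> 1" "d \<ge> 1" "coprime a b" "t > Bplus a b d"
  shows "0 \<le> beta_vec a b d t $ 1" "beta_vec a b d t $ 1 < a + b"
proof -
  let ?w = "beta_vec a b d t"
  note w = beta_vec_is_arg_min[OF assms(1-5)]
  show "0 \<le> ?w $ 1" using w by (simp add: is_arg_min_def Oplus_def)
  show "?w $ 1 < a + b"
  proof (rule ccontr)
    assume "\<not> ?w $ 1 < a + b"
    then have "?w + hvec a b \<in> Oplus a b d t \<and> len (?w + hvec a b) = d"
      using w assms(1-3) unfolding is_arg_min_def length_d_iff[OF assms(3)]
      by (simp add: algebra_simps)
    then show False using w assms(1,2) unfolding is_arg_min_def by force
  qed
qed

lemma lat_diff: "v \<in> lat a b d s \<Longrightarrow> w \<in> lat a b d s \<Longrightarrow> v - w \<in> lat a b d s"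
  by (simp add: lat_def right_diff_distrib)

lemma finite_hilbert_basis_Oplus:
  assumes "a \<ge> 1" "b \<ge> 1" "d \<ge> 1" "s > d * a"
  shows "finite (hilbert_basis (Oplus a b d s))"
proof -
  define N where "N = s + d * b"
  have N: "N > 0" proof -
    have "d * a > 0" "d * b > 0" using assms by simp_all
    with assms(4) show ?thesis unfolding N_def by linarith
  qed
  have bound: "v $ 0 \<le> N \<and> v $ 1 \<le> N" if v: "v \<in> hilbert_basis (Oplus a b d s)" for v
  proof (rule ccontr)
    assume big: "\<not> (v $ 0 \<le> N \<and> v $ 1 \<le> N)"
    have vO: "v \<in> Oplus a b d s" and irr: "\<not> reducible (Oplus a b d s) v"
      using v by (auto simp: hilbert_basis_def)
    obtain e :: "int ^ 3" where e: "e $ 0 = N" "e $ 1 = 0" "e $ 2 = - (s - d * a)"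
      using ex_vec3 by blast
    obtain f :: "int ^ 3" where f: "f $ 0 = 0" "f $ 1 = N" "f $ 2 = - s"
      using ex_vec3 by blast
    have ef: "e \<in> Oplus a b d s" "f \<in> Oplus a b d s" "e \<noteq> 0" "f \<noteq> 0"
      unfolding Oplus_def lat_def vec3_eq_iff mem_Collect_eq e f
      using N by (auto simp: N_def algebra_simps)
    have red: "reducible (Oplus a b d s) v"
      if "u \<in> Oplus a b d s" "u \<noteq> 0" "v - u \<in> Oplus a b d s" "v - u \<noteq> 0" for u
      unfolding reducible_def using that by (intro bexI[of _ u] bexI[of _ "v - u"]) auto
    from big consider "v $ 0 > N" | "v $ 1 > N" by linarith
    then show False
    proof cases
      case 1
      then have "v - e \<in> Oplus a b d s" "v - e \<noteq> 0"
        using vO ef(1) e by (auto simp: Oplus_def vec3_eq_iff intro: lat_diff)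
      with red ef irr show False by blast
    next
      case 2
      then have "v - f \<in> Oplus a b d s" "v - f \<noteq> 0"
        using vO ef(2) f by (auto simp: Oplus_def vec3_eq_iff intro: lat_diff)
      with red ef irr show False by blast
    qed
  qed
  have "inj_on (\<lambda>v::int ^ 3. (v $ 0, v $ 1)) (Oplus a b d s)"
  proof (rule inj_onI)
    fix v w assume vw: "v \<in> Oplus a b d s" "w \<in> Oplus a b d s"
      and eq: "(v $ 0, v $ 1) = (w $ 0, w $ 1)"
    then have "N * v $ 2 = N * w $ 2"
      unfolding Oplus_def lat_def N_def mem_Collect_eq prod.inject by (metis add_left_cancel)
    with N eq show "v = w" by (simp add: vec3_eq_iff)
  qed
  then have "inj_on (\<lambda>v::int ^ 3. (v $ 0, v $ 1)) (hilbert_basis (Oplus a b d s))"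
    by (rule inj_on_subset) (auto simp: hilbert_basis_def)
  moreover have "(\<lambda>v. (v $ 0, v $ 1)) ` hilbert_basis (Oplus a b d s) \<subseteq> {0..N} \<times> {0..N}"
    using bound by (auto simp: hilbert_basis_def Oplus_def)
  ultimately show ?thesis
    by (meson finite_SigmaI finite_atLeastAtMost_int inj_on_finite)
qed

end

theory Submission
  imports Defs
begin

text \<open>
  Rewriting the equation of the lattice for \<open>s\<close> as \<open>s \<cdot> \<ell>(v) = d (a v\<^sub>0 - b v\<^sub>2)\<close> and using
  \<open>gcd(s, d) = 1\<close>, every lattice vector has length \<open>d l\<close> for an integer \<open>l\<close>, its level. Eliminating
  \<open>v\<^sub>2\<close>, the monoid \<open>\<O>\<^sub>s\<^sup>+\<close> becomes a planar one:
  with \<open>p = a + b\<close>, \<open>q = b\<close>, \<open>N = s + d b\<close> it consists of the pairs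
  \<open>x, y \<ge> 0\<close> with \<open>p x + q y = N l\<close>. Here \<open>p\<close> and \<open>q\<close> are coprime, the hypothesis \<open>s > B\<^sup>+\<close> says
  exactly that \<open>N\<close> exceeds the Frobenius number \<open>p q - p - q\<close>, and replacing \<open>s\<close> by
  \<open>s + \<rho>\<close> replaces \<open>N\<close> by \<open>N + (d a) p q\<close>. The two maps move a point of level \<open>l\<close> parallel to an
  axis: \<open>\<phi>\<^sub>1\<^sub>2\<close> adds \<open>d a p l\<close> to \<open>y\<close> and \<open>\<phi>\<^sub>0\<^sub>2\<close> adds \<open>d a q l\<close> to \<open>x\<close>.

  Everything rests on two facts about such pairs. By \<open>frobenius_gap\<close>, an integer
  solution of positive level with \<open>x < q\<close> automatically has \<open>y \<ge> 0\<close>. So in the strip \<open>x < q\<close>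
  the inequality \<open>y \<ge> 0\<close> holds by itself, \<open>\<phi>\<^sub>1\<^sub>2\<close> is a bijection between the strips for
  \<open>s\<close> and \<open>s + \<rho>\<close>, and because both summands of a vector in the strip stay in the strip, it preserves and
  reflects reducibility. The strip \<open>y < p\<close> is symmetric.

  By \<open>level_one_below\<close>, a point of level at least \<open>2\<close> lying in both strips or
  in neither dominates a point of level one, hence is reducible. Therefore the Hilbert basis is the
  disjoint union of the level-one points (irreducible because levels add) and the
  irreducible points of higher level in exactly one of the strips. The maps carry the
  latter pieces for \<open>s\<close> bijectively to those for \<open>s + \<rho>\<close>. The level-one points form the segment
  from \<open>\<alpha>\<close> to \<open>\<beta>\<close> with step \<open>h\<close>; its end points move to \<open>\<phi>\<^sub>1\<^sub>2(\<alpha>)\<close> and \<open>\<phi>\<^sub>0\<^sub>2(\<beta>)\<close>, and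
  comparing first coordinates shows that it gains \<open>d a\<close> points.
\<close>

section \<open>Coin equations above the Frobenius number\<close>

text \<open>
  The number \<open>q y = N l - p x \<ge> N - p (q - 1)\<close> is greater than \<open>-q\<close>, and it is a multiple of \<open>q\<close>.
\<close>

lemma frobenius_gap:
  fixes p q N l x y :: int
  assumes "p > 0" "q > 0" "N > 0" "N > p * q - p - q" "l \<ge> 1" "x < q"
    and eq: "p * x + q * y = N * l"
  shows "y \<ge> 0"
proof -
  have "p * x \<le> p * (q - 1)"
    using assms by (intro mult_left_mono) auto
  moreover have "N * 1 \<le> N * l"
    using assms by (intro mult_left_mono) auto
  ultimately have "q * y > q * (-1)"
    using eq assms(4) by (simp add: algebra_simps)
  then show ?thesis
    using assms(2) by (subst (asm) mult_less_cancel_left_pos) auto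
qed

text \<open>
  The points of level one are spaced by \<open>(q, -p)\<close>. Let \<open>(x0, y0)\<close> be the one with
  \<open>0 \<le> x0 < q\<close> and \<open>(x1, y1)\<close> the one with \<open>0 \<le> y1 < p\<close>; by the gap lemma both lie in the quadrant.
  The gap lemma applied to a difference shows that a level-one point with
  \<open>x - q < x' \<le> x\<close> also has \<open>y' \<le> y\<close>, and similarly with the coordinates exchanged. If \<open>(x, y)\<close>
  lies in both strips, this applies to \<open>(x0, y0)\<close> or to \<open>(x1, y1)\<close>. If it lies in
  neither, step from \<open>(x0, y0)\<close> by \<open>(q, -p)\<close> as long as \<open>x' \<le> x\<close> and \<open>y' \<ge> 0\<close>.
\<close>

lemma level_one_below:
  fixes p q N l x y :: int
  assumes pos: "p > 0" "q > 0" "N > 0" and cop: "coprime p q" and N: "N > p * q - p - q"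
    and l: "l \<ge> 2" and eq: "p * x + q * y = N * l"
    and strips: "x < q \<longleftrightarrow> y < p"
  obtains x' y' where "0 \<le> x'" "x' \<le> x" "0 \<le> y'" "y' \<le> y" "p * x' + q * y' = N"
proof -
  obtain r z where rz: "r * p + z * q = 1"
    using bezout_int[of p q] cop by (auto simp: coprime_iff_gcd_eq_1)
  define x0 where "x0 = (r * N) mod q"
  define y0 where "y0 = z * N + p * ((r * N) div q)"
  have x0: "0 \<le> x0" "x0 < q"
    using pos by (auto simp: x0_def)
  have x0': "x0 = r * N - q * ((r * N) div q)"
    by (simp add: x0_def minus_mult_div_eq_mod)
  have "p * x0 + q * y0 = (r * p + z * q) * N"
    unfolding x0' y0_def by (simp add: algebra_simps)
  then have e0: "p * x0 + q * y0 = N"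
    by (simp add: rz)
  have y0: "y0 \<ge> 0"
    using frobenius_gap[OF pos N, of 1 x0 y0] x0 e0 by simp
  define j where "j = y0 div p"
  define x1 where "x1 = x0 + j * q"
  define y1 where "y1 = y0 - j * p"
  have "y1 = y0 mod p"
    by (simp add: y1_def j_def minus_div_mult_eq_mod)
  then have y1: "0 \<le> y1" "y1 < p"
    using pos by auto
  have j: "j \<ge> 0"
    using y0 pos by (simp add: j_def pos_imp_zdiv_nonneg_iff)
  then have x1: "x1 \<ge> 0"
    using x0 pos by (simp add: x1_def)
  have e1: "p * x1 + q * y1 = N"
    using e0 by (simp add: x1_def y1_def algebra_simps)
  have below_y: "y' \<le> y" if "p * x' + q * y' = N" "x - x' < q" for x' y'
  proof -
    have "p * (x - x') + q * (y - y') = N * (l - 1)"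
      using eq that(1) by (simp add: algebra_simps)
    then show ?thesis
      using frobenius_gap[OF pos N, of "l - 1" "x - x'" "y - y'"] l that(2) by simp
  qed
  have below_x: "x' \<le> x" if "p * x' + q * y' = N" "y - y' < p" for x' y'
  proof -
    have "q * (y - y') + p * (x - x') = N * (l - 1)"
      using eq that(1) by (simp add: algebra_simps)
    then show ?thesis
      using frobenius_gap[OF pos(2,1,3), of "l - 1" "y - y'" "x - x'"] N l that(2)
      by (simp add: algebra_simps)
  qed
  show ?thesis
  proof (cases "x < q")
    case True
    then have yp: "y < p"
      using strips by simp
    consider "x0 \<le> x" | "y1 \<le> y" | "x < x0" "y < y1"
      by linarith
    then show ?thesis
    proof cases
      case 1
      then show ?thesis
        using that[of x0 y0] below_y[OF e0] e0 x0 y0 True by simp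
    next
      case 2
      then show ?thesis
        using that[of x1 y1] below_x[OF e1] e1 x1 y1 yp by simp
    next
      case 3
      \<comment> \<open>Then \<open>(x, y)\<close> is strictly below \<open>(x0, y0)\<close>, so its level is less than one.\<close>
      have "y1 \<le> y0"
        using j pos by (simp add: y1_def)
      then have "p * x + q * y < p * x0 + q * y0"
        using 3 pos by (intro add_strict_mono) auto
      moreover have "N * 1 \<le> N * l"
        using l pos by (intro mult_left_mono) auto
      ultimately show ?thesis
        using e0 eq by simp
    qed
  next
    case False
    then have big: "q \<le> x" "p \<le> y"
      using strips by simp_all
    define k where "k = (x - x0) div q"
    define x2 where "x2 = x0 + k * q"
    define y2 where "y2 = y0 - k * p"
    have "x - x2 = (x - x0) mod q"
      using minus_div_mult_eq_mod[of "x - x0" q] by (simp add: x2_def k_def algebra_simps)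
    then have x2: "x2 \<le> x" "x - x2 < q"
      using pos pos_mod_sign[of q "x - x0"] pos_mod_bound[of q "x - x0"] by linarith+
    have "k \<ge> 0"
      using big x0 pos by (simp add: k_def pos_imp_zdiv_nonneg_iff)
    then have x2': "x2 \<ge> 0"
      using x0 pos by (simp add: x2_def)
    have e2: "p * x2 + q * y2 = N"
      using e0 by (simp add: x2_def y2_def algebra_simps)
    show ?thesis
    proof (cases "y2 \<ge> 0")
      case True
      then show ?thesis
        using that[of x2 y2] x2 x2' e2 below_y[OF e2] by simp
    next
      case False
      \<comment> \<open>The step to \<open>x2\<close> overshoots the segment; its last point is then below.\<close>
      then have "y0 < k * p"
        by (simp add: y2_def)
      moreover have "j * p \<le> y0"
        using y1 by (simp add: y1_def)
      ultimately have "j * p < k * p"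
        by linarith
      then have "j < k"
        using pos by simp
      then have "x1 \<le> x2"
        using pos by (simp add: x1_def x2_def)
      then show ?thesis
        using that[of x1 y1] x1 y1 x2 big e1 by simp
    qed
  qed
qed

section \<open>Reducibility under linear bijections\<close>

text \<open>
  The part of a monoid where an additive function, nonnegative on the monoid, stays below a
  bound is closed under passing to summands. So reducibility of its elements is decided inside
  it, and two monoids need only correspond there.
\<close>

lemma reducible_transfer:
  fixes \<phi> :: "int ^ 3 \<Rightarrow> int ^ 3" and f :: "int ^ 3 \<Rightarrow> int"
  assumes add: "\<And>u w. \<phi> (u + w) = \<phi> u + \<phi> w" and inj: "inj \<phi>" and surj: "surj \<phi>"
    and f_add: "\<And>u w. f (u + w) = f u + f w" and f_phi: "\<And>u. f (\<phi> u) = f u"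
    and M: "\<And>u. u \<in> M \<Longrightarrow> f u \<ge> 0" and M': "\<And>u. u \<in> M' \<Longrightarrow> f u \<ge> 0"
    and corr: "\<And>u. f u < c \<Longrightarrow> \<phi> u \<in> M' \<longleftrightarrow> u \<in> M"
    and v: "f v < c"
  shows "reducible M' (\<phi> v) \<longleftrightarrow> reducible M v"
proof -
  have zero: "\<phi> u = 0 \<longleftrightarrow> u = 0" for u
    using add[of 0 0] inj by (metis add_cancel_right_right injD)
  show ?thesis
  proof
    assume "reducible M v"
    then obtain u w where uw: "u \<in> M" "w \<in> M" "u \<noteq> 0" "w \<noteq> 0" "v = u + w"
      unfolding reducible_def by blast
    then have "f u < c" "f w < c"
      using M[of u] M[of w] f_add[of u w] v by auto
    then have "\<phi> u \<in> M'" "\<phi> w \<in> M'"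
      using corr uw by auto
    then show "reducible M' (\<phi> v)"
      unfolding reducible_def using uw zero add by metis
  next
    assume "reducible M' (\<phi> v)"
    then obtain u' w' where uw': "u' \<in> M'" "w' \<in> M'" "u' \<noteq> 0" "w' \<noteq> 0" "\<phi> v = u' + w'"
      unfolding reducible_def by blast
    obtain u w where uw: "u' = \<phi> u" "w' = \<phi> w"
      using surj by (metis surjD)
    have sum: "v = u + w"
      using uw uw'(5) add inj by (metis injD)
    then have "f u < c" "f w < c"
      using M'[OF uw'(1)] M'[OF uw'(2)] f_add[of u w] f_phi uw v by auto
    then have "u \<in> M" "w \<in> M"
      using corr uw uw' by auto
    then show "reducible M v"
      unfolding reducible_def using sum uw uw' zero by metis
  qed
qed

lemma len_phi [simp]: "len (phi12 a b v) = len v" "len (phi02 a b v) = len v"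
  by (simp_all add: len_def)

lemma len_add: "len (u + w) = len u + len w"
  by (simp add: len_def)

lemma phi_add:
  "phi12 a b (u + w) = phi12 a b u + phi12 a b w"
  "phi02 a b (u + w) = phi02 a b u + phi02 a b w"
  by (simp_all add: vec3_eq_iff len_add algebra_simps)

lemma inj_phi: "inj (phi12 a b)" "inj (phi02 a b)"
proof -
  have "u = w" if "phi12 a b u = phi12 a b w" for u w
    using that arg_cong[OF that, of len] by (simp add: vec3_eq_iff)
  then show "inj (phi12 a b)"
    by (rule injI)
  have "u = w" if "phi02 a b u = phi02 a b w" for u w
    using that arg_cong[OF that, of len] by (simp add: vec3_eq_iff)
  then show "inj (phi02 a b)"
    by (rule injI)
qed

lemma phi_eq_0_iff: "phi12 a b v = 0 \<longleftrightarrow> v = 0" "phi02 a b v = 0 \<longleftrightarrow> v = 0"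
proof -
  have "phi12 a b 0 = 0" "phi02 a b 0 = 0"
    using phi_add[of a b 0 0] by simp_all
  then show "phi12 a b v = 0 \<longleftrightarrow> v = 0" "phi02 a b v = 0 \<longleftrightarrow> v = 0"
    using inj_eq[OF inj_phi(1), of a b v 0] inj_eq[OF inj_phi(2), of a b v 0] by simp_all
qed

lemma surj_phi: "surj (phi12 a b)" "surj (phi02 a b)"
proof -
  \<comment> \<open>Both maps fix the length, so the translation by a multiple of it is undone by its negative.\<close>
  have "\<exists>u. v = phi12 a b u" for v
  proof -
    obtain u :: "int ^ 3" where u: "u $ 0 = v $ 0" "u $ 1 = v $ 1 - a * (a + b) * len v"
      "u $ 2 = v $ 2 + a * (a + b) * len v"
      using ex_vec3 by blast
    then have "len u = len v"
      by (simp add: len_def)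
    then show ?thesis
      using u by (intro exI[of _ u]) (simp add: vec3_eq_iff)
  qed
  then show "surj (phi12 a b)"
    by (auto simp: surj_def)
  have "\<exists>u. v = phi02 a b u" for v
  proof -
    obtain u :: "int ^ 3" where u: "u $ 0 = v $ 0 - a * b * len v" "u $ 1 = v $ 1"
      "u $ 2 = v $ 2 + a * b * len v"
      using ex_vec3 by blast
    then have "len u = len v"
      by (simp add: len_def)
    then show ?thesis
      using u by (intro exI[of _ u]) (simp add: vec3_eq_iff)
  qed
  then show "surj (phi02 a b)"
    by (auto simp: surj_def)
qed

lemma phi_lat_iff:
  "phi12 a b v \<in> lat a b d (s + rho a b d) \<longleftrightarrow> v \<in> lat a b d s"
  "phi02 a b v \<in> lat a b d (s + rho a b d) \<longleftrightarrow> v \<in> lat a b d s"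
  by (simp_all add: lat_def rho_def len_def algebra_simps)

section \<open>The Hilbert basis above the Frobenius bound\<close>

locale lattice_cone =
  fixes a b d s :: int
  assumes a: "a \<ge> 1" and b: "b \<ge> 1" and d: "d \<ge> 1" and ab: "coprime a b"
    and s: "s > d * a" and sd: "coprime s d" and sB: "s > Bplus a b d"
begin

abbreviation "N \<equiv> s + d * b"

abbreviation "level_one \<equiv> {v \<in> Oplus a b d s. len v = d}"

lemma N_pos: "N > 0"
proof -
  have "d * a > 0" "d * b > 0"
    using a b d by simp_all
  then show ?thesis
    using s by linarith
qed

lemma N_frobenius: "N > (a + b) * b - (a + b) - b"
  using sB by (simp add: Bplus_def algebra_simps)

lemma coprime_pq: "coprime (a + b) b"
  using ab by (simp add: coprime_iff_gcd_eq_1)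

lemma pos: "a + b > 0" "b > 0"
  using a b by simp_all

lemma Oplus_nonneg: "v \<in> Oplus a b d r \<Longrightarrow> v $ 0 \<ge> 0" "v \<in> Oplus a b d r \<Longrightarrow> v $ 1 \<ge> 0"
  by (simp_all add: Oplus_def)

lemma lat_iff:
  "v \<in> lat a b d s \<longleftrightarrow> (\<exists>l. len v = d * l \<and> (a + b) * v $ 0 + b * v $ 1 = N * l)"
proof -
  have lat: "v \<in> lat a b d s \<longleftrightarrow> s * len v = d * (a * v $ 0 - b * v $ 2)"
    by (auto simp: lat_def len_def algebra_simps)
  have plane: "(a + b) * v $ 0 + b * v $ 1 = b * len v + (a * v $ 0 - b * v $ 2)"
    by (simp add: len_def algebra_simps)
  show ?thesis
  proof
    assume "v \<in> lat a b d s"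
    then have eq: "s * len v = d * (a * v $ 0 - b * v $ 2)"
      using lat by simp
    then have "d dvd s * len v"
      by simp
    then have "d dvd len v"
      using sd by (simp add: coprime_commute coprime_dvd_mult_right_iff)
    then obtain l where l: "len v = d * l" ..
    have "d * (s * l) = d * (a * v $ 0 - b * v $ 2)"
      using eq l by (simp add: algebra_simps)
    then have "a * v $ 0 - b * v $ 2 = s * l"
      using d by simp
    then show "\<exists>l. len v = d * l \<and> (a + b) * v $ 0 + b * v $ 1 = N * l"
      using l plane by (intro exI[of _ l]) (simp add: algebra_simps)
  next
    assume "\<exists>l. len v = d * l \<and> (a + b) * v $ 0 + b * v $ 1 = N * l"
    then obtain l where l: "len v = d * l" "(a + b) * v $ 0 + b * v $ 1 = N * l"
      by blast
    then have "a * v $ 0 - b * v $ 2 = s * l"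
      using plane by (simp add: algebra_simps)
    then show "v \<in> lat a b d s"
      using lat l by (simp add: algebra_simps)
  qed
qed

lemma lat_level:
  assumes "v \<in> lat a b d s"
  obtains l where "len v = d * l" "(a + b) * v $ 0 + b * v $ 1 = N * l"
  using assms lat_iff by blast

lemma Oplus_level:
  assumes "v \<in> Oplus a b d s"
  obtains l where "len v = d * l" "(a + b) * v $ 0 + b * v $ 1 = N * l" "l \<ge> 0"
    "v \<noteq> 0 \<Longrightarrow> l \<ge> 1"
proof -
  have v: "v \<in> lat a b d s" "v $ 0 \<ge> 0" "v $ 1 \<ge> 0"
    using assms by (auto simp: Oplus_def)
  obtain l where l: "len v = d * l" "(a + b) * v $ 0 + b * v $ 1 = N * l"
    using v lat_level by blast
  have nonneg: "(a + b) * v $ 0 \<ge> 0" "b * v $ 1 \<ge> 0"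
    using v pos by simp_all
  then have l0: "l \<ge> 0"
    using l(2) N_pos by (metis add_nonneg_nonneg zero_le_mult_iff not_less)
  have "v = 0" if "l = 0"
  proof -
    have "(a + b) * v $ 0 = 0" "b * v $ 1 = 0"
      using l(2) nonneg unfolding \<open>l = 0\<close> by linarith+
    then have "v $ 0 = 0" "v $ 1 = 0"
      using pos by simp_all
    then show ?thesis
      using that l(1) by (simp add: vec3_eq_iff len_def)
  qed
  with l0 have "v \<noteq> 0 \<Longrightarrow> l \<ge> 1"
    by force
  then show ?thesis
    using that l l0 by blast
qed

lemma len_ge:
  assumes "v \<in> Oplus a b d s" "v \<noteq> 0"
  shows "len v \<ge> d"
proof -
  obtain l where l: "len v = d * l" "v \<noteq> 0 \<Longrightarrow> l \<ge> 1"
    using Oplus_level[OF assms(1)] by blast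
  then have "d * 1 \<le> d * l"
    using assms(2) d by (intro mult_left_mono) auto
  then show ?thesis
    using l by simp
qed

lemma len_nonneg: "v \<in> Oplus a b d s \<Longrightarrow> len v \<ge> 0"
  using len_ge[of v] d by (cases "v = 0") (auto simp: len_def)

text \<open>Lengths add, and two nonzero summands have total length at least \<open>2 d\<close>.\<close>

lemma level_one_irreducible: "level_one \<subseteq> hilbert_basis (Oplus a b d s)"
proof
  fix v assume v: "v \<in> level_one"
  have "\<not> reducible (Oplus a b d s) v"
  proof
    assume "reducible (Oplus a b d s) v"
    then obtain u w where uw: "u \<in> Oplus a b d s" "w \<in> Oplus a b d s" "u \<noteq> 0" "w \<noteq> 0" "v = u + w"
      unfolding reducible_def by blast
    then show False
      using v len_ge[OF uw(1,3)] len_ge[OF uw(2,4)] d by (simp add: len_add)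
  qed
  moreover have "v \<noteq> 0"
    using v d by (auto simp: len_def)
  ultimately show "v \<in> hilbert_basis (Oplus a b d s)"
    using v by (simp add: hilbert_basis_def)
qed

text \<open>
  A vector of higher level lying in both strips or in neither splits off the
  level-one vector found below it in the plane.
\<close>

lemma hilbert_basis_one_strip:
  assumes v: "v \<in> hilbert_basis (Oplus a b d s)" and len: "len v \<noteq> d"
  shows "v $ 0 < b \<longleftrightarrow> \<not> v $ 1 < a + b"
proof (rule ccontr)
  assume contr: "\<not> (v $ 0 < b \<longleftrightarrow> \<not> v $ 1 < a + b)"
  have vO: "v \<in> Oplus a b d s" and v0: "v \<noteq> 0" and irr: "\<not> reducible (Oplus a b d s) v"
    using v by (auto simp: hilbert_basis_def)
  have vlat: "v \<in> lat a b d s"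
    using vO by (auto simp: Oplus_def)
  obtain l where l: "len v = d * l" "(a + b) * v $ 0 + b * v $ 1 = N * l" "l \<ge> 1"
    using Oplus_level[OF vO] v0 by metis
  have "l \<noteq> 1"
    using len l by auto
  then have "l \<ge> 2"
    using l by simp
  then obtain x y where xy: "0 \<le> x" "x \<le> v $ 0" "0 \<le> y" "y \<le> v $ 1" "(a + b) * x + b * y = N"
    using level_one_below[OF pos N_pos coprime_pq N_frobenius _ l(2)] contr by blast
  obtain u :: "int ^ 3" where u: "u $ 0 = x" "u $ 1 = y" "u $ 2 = d - x - y"
    using ex_vec3 by blast
  have lenu: "len u = d"
    using u by (simp add: len_def)
  have ulat: "u \<in> lat a b d s"
    unfolding lat_iff using xy u lenu by (intro exI[of _ 1]) simp
  have uO: "u \<in> Oplus a b d s"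
    using ulat xy u by (simp add: Oplus_def)
  have wO: "v - u \<in> Oplus a b d s"
    using lat_diff[OF vlat ulat] xy u by (simp add: Oplus_def)
  have "u \<noteq> 0" "v - u \<noteq> 0"
    using lenu len d by (auto simp: len_def)
  then have "reducible (Oplus a b d s) v"
    unfolding reducible_def using uO wO by (intro bexI[of _ u] bexI[of _ "v - u"]) auto
  then show False
    using irr by simp
qed

lemma hilbert_basis_strips:
  "hilbert_basis (Oplus a b d s) \<subseteq> S12plus a b d s \<union> S02plus a b d s \<union> level_one"
proof
  fix v assume v: "v \<in> hilbert_basis (Oplus a b d s)"
  then have "v \<in> Oplus a b d s"
    by (simp add: hilbert_basis_def)
  then show "v \<in> S12plus a b d s \<union> S02plus a b d s \<union> level_one"
    using hilbert_basis_one_strip[OF v] by (auto simp: S12plus_def S02plus_def)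
qed

text \<open>Outside level one, the two strips share no irreducible vector, so the cardinalities add.\<close>

lemma card_hilbert_basis:
  "card (hilbert_basis (Oplus a b d s)) =
    card (hilbert_basis (Oplus a b d s) \<inter> S12plus a b d s - {v. len v = d}) +
    card (hilbert_basis (Oplus a b d s) \<inter> S02plus a b d s - {v. len v = d}) + card level_one"
  (is "card ?H = card ?A + card ?B + card ?L")
proof -
  have fin: "finite ?H"
    using finite_hilbert_basis_Oplus a b d s by blast
  have finL: "finite ?L"
    using fin level_one_irreducible finite_subset by blast
  have H: "?H = (?A \<union> ?B) \<union> ?L"
  proof
    show "?H \<subseteq> (?A \<union> ?B) \<union> ?L"
      using hilbert_basis_strips by (auto simp: hilbert_basis_def)
    show "(?A \<union> ?B) \<union> ?L \<subseteq> ?H"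
      using level_one_irreducible by blast
  qed
  have "?A \<inter> ?B = {}"
    using hilbert_basis_one_strip by (auto simp: S12plus_def S02plus_def)
  then have "card (?A \<union> ?B) = card ?A + card ?B"
    using fin by (intro card_Un_disjoint) auto
  moreover have "card ((?A \<union> ?B) \<union> ?L) = card (?A \<union> ?B) + card ?L"
    using fin finL by (intro card_Un_disjoint) auto
  ultimately show ?thesis
    using H by metis
qed

text \<open>
  The level-one vectors form one line with step \<open>h\<close>, along which coordinate \<open>0\<close> increases
  and coordinate \<open>1\<close> decreases. A vector with coordinate \<open>0\<close> below \<open>b\<close> is
  the first in the cone, and one with coordinate \<open>1\<close> below \<open>a + b\<close> is the last.
\<close>

lemma level_one_segment:
  assumes u: "u \<in> level_one" "u $ 0 < b" and w: "w \<in> level_one" "w $ 1 < a + b"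
  obtains m :: nat where "u + int m *s hvec a b = w"
    "level_one = {u + int k *s hvec a b | k::nat. k \<le> m}" "card level_one = m + 1"
proof -
  have line: "\<exists>k. v = u + k *s hvec a b" if "v \<in> level_one" for v
    using length_d_diff[OF a b d ab, of v s u] that u by (auto simp: algebra_simps)
  have start: "k \<ge> 0" if "u + k *s hvec a b \<in> level_one" for k
  proof (rule ccontr)
    assume "\<not> k \<ge> 0"
    then have "k * b \<le> (-1) * b"
      using pos by (intro mult_right_mono) auto
    then show False
      using that u by (auto simp: Oplus_def)
  qed
  obtain m' where m': "w = u + m' *s hvec a b"
    using line w by blast
  have "m' \<ge> 0"
    using start m' w by blast
  then obtain m where m: "m' = int m"
    using nonneg_int_cases by blast
  have stop: "k \<le> m'" if "u + k *s hvec a b \<in> level_one" for k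
  proof (rule ccontr)
    assume "\<not> k \<le> m'"
    then have "(m' + 1) * (a + b) \<le> k * (a + b)"
      using pos by (intro mult_right_mono) auto
    moreover have "u $ 1 - k * (a + b) \<ge> 0"
      using that by (simp add: Oplus_def algebra_simps)
    moreover have "u $ 1 - m' * (a + b) < a + b"
      using w m' by (simp add: algebra_simps)
    ultimately show False
      by (simp add: algebra_simps)
  qed
  have mem: "u + k *s hvec a b \<in> level_one" if k: "0 \<le> k" "k \<le> m'" for k
  proof -
    have "k * (a + b) \<le> m' * (a + b)" "0 \<le> k * b"
      using k pos by (auto intro: mult_right_mono)
    moreover have "u $ 1 - m' * (a + b) \<ge> 0" "u $ 0 \<ge> 0"
      using w m' u by (simp_all add: Oplus_def algebra_simps)
    moreover have "u $ 0 + u $ 1 + u $ 2 = d" "a * u $ 0 - b * u $ 2 = s"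
      using u length_d_iff[OF d, of u] by blast+
    ultimately have "u + k *s hvec a b \<in> Oplus a b d s \<and> len (u + k *s hvec a b) = d"
      unfolding length_d_iff[OF d] by (simp add: algebra_simps)
    then show ?thesis
      by simp
  qed
  have eq: "level_one = {u + int k *s hvec a b | k::nat. k \<le> m}"
  proof (intro set_eqI iffI)
    fix v assume v: "v \<in> level_one"
    then obtain k where k: "v = u + k *s hvec a b"
      using line by blast
    then have "0 \<le> k" "k \<le> int m"
      using start[of k] stop[of k] v m by simp_all
    then show "v \<in> {u + int k *s hvec a b | k::nat. k \<le> m}"
      using k by (auto intro!: exI[of _ "nat k"])
  next
    fix v assume "v \<in> {u + int k *s hvec a b | k::nat. k \<le> m}"
    then show "v \<in> level_one"
      using mem m by fastforce
  qed
  also have "\<dots> = (\<lambda>k. u + int k *s hvec a b) ` {..m}"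
    by auto
  also have "card \<dots> = m + 1"
    using b by (subst card_image) (auto intro!: inj_onI simp: vec3_eq_iff)
  finally show ?thesis
    using that m m' eq by blast
qed

section \<open>Passing from s to s + \<rho>\<close>

lemma shift: "lattice_cone a b d (s + rho a b d)"
proof
  have "rho a b d \<ge> 0"
    using a b d by (simp add: rho_def)
  then show "s + rho a b d > d * a" "s + rho a b d > Bplus a b d"
    using s sB by linarith+
  have "s + rho a b d = (a * b * (a + b)) * d + s"
    by (simp add: rho_def)
  then show "coprime (s + rho a b d) d"
    using sd by (metis coprime_iff_gcd_eq_1 gcd.commute gcd_add_mult)
qed (use a b d ab in auto)

text \<open>
  In the strip, the only inequality that the map could create or destroy is
  \<open>y \<ge> 0\<close>, and it holds on both sides by the gap lemma.
\<close>

lemma phi12_mem_iff: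
  assumes strip: "v $ 0 < b"
  shows "phi12 a b v \<in> Oplus a b d (s + rho a b d) \<longleftrightarrow> v \<in> Oplus a b d s"
proof
  assume v: "v \<in> Oplus a b d s"
  have "a * (a + b) * len v \<ge> 0"
    using len_nonneg[OF v] a b by simp
  then show "phi12 a b v \<in> Oplus a b d (s + rho a b d)"
    using v by (simp add: Oplus_def phi_lat_iff)
next
  interpret shifted: lattice_cone a b d "s + rho a b d"
    by (rule shift)
  assume v': "phi12 a b v \<in> Oplus a b d (s + rho a b d)"
  then have v: "v \<in> lat a b d s" "v $ 0 \<ge> 0"
    by (simp_all add: Oplus_def phi_lat_iff)
  show "v \<in> Oplus a b d s"
  proof (cases "v = 0")
    case True
    then show ?thesis
      using v by (simp add: Oplus_def)
  next
    case False
    then have "phi12 a b v \<noteq> 0"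
      by (simp add: phi_eq_0_iff)
    then have ge: "len v \<ge> d"
      using shifted.len_ge[OF v'] by simp
    obtain l where l: "len v = d * l" "(a + b) * v $ 0 + b * v $ 1 = N * l"
      using v lat_level by blast
    have "l \<ge> 1"
      using ge l d by simp
    then have "v $ 1 \<ge> 0"
      using frobenius_gap[OF pos N_pos N_frobenius] strip l(2) by blast
    then show ?thesis
      using v by (simp add: Oplus_def)
  qed
qed

lemma phi02_mem_iff:
  assumes strip: "v $ 1 < a + b"
  shows "phi02 a b v \<in> Oplus a b d (s + rho a b d) \<longleftrightarrow> v \<in> Oplus a b d s"
proof
  assume v: "v \<in> Oplus a b d s"
  have "a * b * len v \<ge> 0"
    using len_nonneg[OF v] a b by simp
  then show "phi02 a b v \<in> Oplus a b d (s + rho a b d)"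
    using v by (simp add: Oplus_def phi_lat_iff)
next
  interpret shifted: lattice_cone a b d "s + rho a b d"
    by (rule shift)
  assume v': "phi02 a b v \<in> Oplus a b d (s + rho a b d)"
  then have v: "v \<in> lat a b d s" "v $ 1 \<ge> 0"
    by (simp_all add: Oplus_def phi_lat_iff)
  show "v \<in> Oplus a b d s"
  proof (cases "v = 0")
    case True
    then show ?thesis
      using v by (simp add: Oplus_def)
  next
    case False
    then have "phi02 a b v \<noteq> 0"
      by (simp add: phi_eq_0_iff)
    then have ge: "len v \<ge> d"
      using shifted.len_ge[OF v'] by simp
    obtain l where l: "len v = d * l" "(a + b) * v $ 0 + b * v $ 1 = N * l"
      using v lat_level by blast
    have "l \<ge> 1"
      using ge l d by simp
    moreover have "b * v $ 1 + (a + b) * v $ 0 = N * l" "N > b * (a + b) - b - (a + b)"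
      using l(2) N_frobenius by (simp_all add: algebra_simps)
    ultimately have "v $ 0 \<ge> 0"
      using frobenius_gap[OF pos(2,1) N_pos] strip by blast
    then show ?thesis
      using v by (simp add: Oplus_def)
  qed
qed

lemma phi12_S12plus_iff: "phi12 a b v \<in> S12plus a b d (s + rho a b d) \<longleftrightarrow> v \<in> S12plus a b d s"
  using phi12_mem_iff by (auto simp: S12plus_def)

lemma phi02_S02plus_iff: "phi02 a b v \<in> S02plus a b d (s + rho a b d) \<longleftrightarrow> v \<in> S02plus a b d s"
  using phi02_mem_iff by (auto simp: S02plus_def)

lemma phi12_reducible_iff:
  assumes "v $ 0 < b"
  shows "reducible (Oplus a b d (s + rho a b d)) (phi12 a b v) \<longleftrightarrow> reducible (Oplus a b d s) v"
  by (rule reducible_transfer[where f = "\<lambda>v. v $ 0" and c = b])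
    (use assms in \<open>simp_all add: phi_add inj_phi surj_phi phi12_mem_iff Oplus_nonneg\<close>)

lemma phi02_reducible_iff:
  assumes "v $ 1 < a + b"
  shows "reducible (Oplus a b d (s + rho a b d)) (phi02 a b v) \<longleftrightarrow> reducible (Oplus a b d s) v"
  by (rule reducible_transfer[where f = "\<lambda>v. v $ 1" and c = "a + b"])
    (use assms in \<open>simp_all add: phi_add inj_phi surj_phi phi02_mem_iff Oplus_nonneg\<close>)

lemma phi12_hilbert_basis:
  "phi12 a b ` (hilbert_basis (Oplus a b d s) \<inter> S12plus a b d s) =
    hilbert_basis (Oplus a b d (s + rho a b d)) \<inter> S12plus a b d (s + rho a b d)"
  (is "_ ` ?A = ?A'")
proof -
  have "phi12 a b v \<in> ?A' \<longleftrightarrow> v \<in> ?A" for v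
    using phi12_mem_iff[of v] phi12_reducible_iff[of v]
    by (auto simp: hilbert_basis_def S12plus_def phi_eq_0_iff)
  then have "?A = phi12 a b -` ?A'"
    by blast
  then show ?thesis
    using surj_image_vimage_eq[OF surj_phi(1)] by metis
qed

lemma phi02_hilbert_basis:
  "phi02 a b ` (hilbert_basis (Oplus a b d s) \<inter> S02plus a b d s) =
    hilbert_basis (Oplus a b d (s + rho a b d)) \<inter> S02plus a b d (s + rho a b d)"
  (is "_ ` ?A = ?A'")
proof -
  have "phi02 a b v \<in> ?A' \<longleftrightarrow> v \<in> ?A" for v
    using phi02_mem_iff[of v] phi02_reducible_iff[of v]
    by (auto simp: hilbert_basis_def S02plus_def phi_eq_0_iff)
  then have "?A = phi02 a b -` ?A'"
    by blast
  then show ?thesis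
    using surj_image_vimage_eq[OF surj_phi(2)] by metis
qed

end

theorem theorem4p5:
  fixes a b d t :: int
  assumes "a \<ge> 1" and "b \<ge> 1" and "d \<ge> 1" and "gcd a b = 1"
    and "t > d * a" and "gcd t d = 1" and "t > Bplus a b d"
  shows "(\<forall>v \<in> S12plus a b d t.
            phi12 a b v \<in> S12plus a b d (t + rho a b d) \<and>
            (reducible (Oplus a b d (t + rho a b d)) (phi12 a b v)
               \<longleftrightarrow> reducible (Oplus a b d t) v))
       \<and> (\<forall>v \<in> S02plus a b d t.
            phi02 a b v \<in> S02plus a b d (t + rho a b d) \<and>
            (reducible (Oplus a b d (t + rho a b d)) (phi02 a b v)
               \<longleftrightarrow> reducible (Oplus a b d t) v))
       \<and> (\<exists>m::nat.
            phi12 a b (alpha_vec a b d t) + int m *s hvec a b = phi02 a b (beta_vec a b d t) \<and>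
            hilbert_basis (Oplus a b d (t + rho a b d)) =
              phi12 a b ` (hilbert_basis (Oplus a b d t) \<inter> S12plus a b d t)
              \<union> phi02 a b ` (hilbert_basis (Oplus a b d t) \<inter> S02plus a b d t)
              \<union> {phi12 a b (alpha_vec a b d t) + int k *s hvec a b | k::nat. k \<le> m})
       \<and> int (card (hilbert_basis (Oplus a b d (t + rho a b d))))
            = int (card (hilbert_basis (Oplus a b d t))) + d * a"
proof -
  interpret lattice_cone a b d t
    using assms by unfold_locales (simp_all add: coprime_iff_gcd_eq_1)
  let ?t' = "t + rho a b d"
  interpret shifted: lattice_cone a b d ?t'
    by (rule shift)
  let ?H = "hilbert_basis (Oplus a b d t)" and ?H' = "hilbert_basis (Oplus a b d ?t')"
  let ?\<alpha> = "alpha_vec a b d t" and ?\<beta> = "beta_vec a b d t"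
  have \<alpha>: "?\<alpha> \<in> level_one" "?\<alpha> $ 0 < b"
    using alpha_vec_is_arg_min[OF a b d ab sB] alpha_vec_lt[OF a b d ab sB]
    by (auto simp: is_arg_min_def)
  have \<beta>: "?\<beta> \<in> level_one" "?\<beta> $ 1 < a + b"
    using beta_vec_is_arg_min[OF a b d ab sB] beta_vec_lt[OF a b d ab sB]
    by (auto simp: is_arg_min_def)
  have \<alpha>': "phi12 a b ?\<alpha> \<in> shifted.level_one" "phi12 a b ?\<alpha> $ 0 < b"
    using \<alpha> phi12_mem_iff[of ?\<alpha>] by auto
  have \<beta>': "phi02 a b ?\<beta> \<in> shifted.level_one" "phi02 a b ?\<beta> $ 1 < a + b"
    using \<beta> phi02_mem_iff[of ?\<beta>] by auto
  obtain m where m: "?\<alpha> + int m *s hvec a b = ?\<beta>" "card level_one = m + 1"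
    by (rule level_one_segment[OF \<alpha> \<beta>])
  obtain m' where m': "phi12 a b ?\<alpha> + int m' *s hvec a b = phi02 a b ?\<beta>"
    "shifted.level_one = {phi12 a b ?\<alpha> + int k *s hvec a b | k::nat. k \<le> m'}"
    "card shifted.level_one = m' + 1"
    by (rule shifted.level_one_segment[OF \<alpha>' \<beta>'])
  have basis: "?H' = phi12 a b ` (?H \<inter> S12plus a b d t) \<union> phi02 a b ` (?H \<inter> S02plus a b d t)
      \<union> {phi12 a b ?\<alpha> + int k *s hvec a b | k::nat. k \<le> m'}"
    unfolding phi12_hilbert_basis phi02_hilbert_basis m'(2)[symmetric]
    using shifted.hilbert_basis_strips shifted.level_one_irreducible by blast
  \<comment> \<open>Coordinate \<open>0\<close> of the two segments: only the end point moves, by \<open>a b d\<close>.\<close>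
  have "?\<alpha> $ 0 + int m * b = ?\<beta> $ 0"
    using arg_cong[OF m(1), of "\<lambda>v. v $ 0"] by simp
  moreover have "?\<alpha> $ 0 + int m' * b = ?\<beta> $ 0 + a * b * d"
    using arg_cong[OF m'(1), of "\<lambda>v. v $ 0"] \<beta> by simp
  ultimately have "int m' * b = (int m + d * a) * b"
    by (simp add: algebra_simps)
  then have mm: "int m' = int m + d * a"
    using b by simp
  have "?H' \<inter> S12plus a b d ?t' - {v. len v = d} = phi12 a b ` (?H \<inter> S12plus a b d t - {v. len v = d})"
    unfolding phi12_hilbert_basis[symmetric] by auto
  then have c12: "card (?H' \<inter> S12plus a b d ?t' - {v. len v = d})
      = card (?H \<inter> S12plus a b d t - {v. len v = d})"
    using inj_phi(1) by (metis card_image inj_on_subset subset_UNIV)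
  have "?H' \<inter> S02plus a b d ?t' - {v. len v = d} = phi02 a b ` (?H \<inter> S02plus a b d t - {v. len v = d})"
    unfolding phi02_hilbert_basis[symmetric] by auto
  then have c02: "card (?H' \<inter> S02plus a b d ?t' - {v. len v = d})
      = card (?H \<inter> S02plus a b d t - {v. len v = d})"
    using inj_phi(2) by (metis card_image inj_on_subset subset_UNIV)
  have card: "int (card ?H') = int (card ?H) + d * a"
    using card_hilbert_basis shifted.card_hilbert_basis c12 c02 m(2) m'(3) mm by simp
  have r12: "\<forall>v \<in> S12plus a b d t. phi12 a b v \<in> S12plus a b d ?t' \<and>
      (reducible (Oplus a b d ?t') (phi12 a b v) \<longleftrightarrow> reducible (Oplus a b d t) v)"
    using phi12_S12plus_iff phi12_reducible_iff by (auto simp: S12plus_def)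
  have r02: "\<forall>v \<in> S02plus a b d t. phi02 a b v \<in> S02plus a b d ?t' \<and>
      (reducible (Oplus a b d ?t') (phi02 a b v) \<longleftrightarrow> reducible (Oplus a b d t) v)"
    using phi02_S02plus_iff phi02_reducible_iff by (auto simp: S02plus_def)
  show ?thesis
    using r12 r02 m'(1) basis card by blast
qed

end
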